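(* Let $G:\mathbb{R}^N\to\mathbb{R}$ be differentiable with locally Lipschitz gradient ($G\in C^{1,1}_{\rm loc}(\mathbb{R}^N;\mathbb{R})$) and let $\bar u$ be a nontrivial critical point of $G$, i.e. $\bar u\in\operatorname{crit}G\setminus\operatorname{int}\operatorname{crit}G$. Assume that $G$ has the KL property at $\bar u$ and that there exists $\eta>0$ such that for every $u\in B(\bar u,\eta)$, $G(u)=G(\bar u)$ implies $u\in\operatorname{crit}G$. Then there exists $\beta>0$ such that for every desingularizing function $\varphi$ of $G$ at $\bar u$, $$\varphi'(s)\ge\frac{\beta}{\sqrt{s}}$$ for every sufficiently small $s>0$.
   Context: $\operatorname{crit}G=\{u\in\mathbb{R}^N;\nabla G(u)=0\}$; $B(\bar u,\eta)$ is the open Euclidean ball of center $\bar u$ and radius $\eta$. KL property and desingularizing function: a differentiable $G:\mathbb{R}^N\to\mathbb{R}$ has the KL property at $\bar u$ if there exist $r_0>0$, $\eta'>0$ and $\varphi\in C([0,r_0);\mathbb{R}_+)$ such that (1) $\varphi(0)=0$, $\varphi$ is $C^1$ on $(0,r_0)$, concave, with $\varphi'>0$ on $(0,r_0)$; (2) $|G(u)-G(\bar u)|<r_0$ for all $u\in B(\bar u,\eta')$, and $\|\nabla(\varphi\circ|G(\cdot)-G(\bar u)|)(u)\|\ge1$ for each $u\in B(\bar u,\eta')$ with $G(u)\ne G(\bar u)$. Such a $\varphi$ is called a desingularizing function of $G$ at $\bar u$ (on $B(\bar u,\eta')$). *)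

theory Defs
  imports "HOL-Analysis.Analysis"
begin

text \<open>Meaningful only at points of differentiability (see the two lemmas below); unspecified
  elsewhere.\<close>
definition grad :: "('a::euclidean_space \<Rightarrow> real) \<Rightarrow> 'a \<Rightarrow> 'a" where
  "grad f u = (THE g. GDERIV f u :> g)"

lemma grad_eqI:
  assumes "GDERIV f u :> g"
  shows "grad f u = g"
proof -
  have "g' = g" if "GDERIV f u :> g'" for g'
  proof -
    have "(\<lambda>h. h \<bullet> g') = (\<lambda>h. h \<bullet> g)"
      using that assms has_derivative_unique unfolding gderiv_def by blast
    then show ?thesis
      by (metis vector_eq_ldot)
  qed
  with assms show ?thesis
    unfolding grad_def by blast
qed

lemma GDERIV_grad:
  assumes "f differentiable (at u)"
  shows "GDERIV f u :> grad f u"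
proof -
  obtain D where D: "(f has_derivative D) (at u)"
    using assms unfolding differentiable_def by blast
  then have "linear D"
    by (rule has_derivative_linear)
  then have "D h = h \<bullet> adjoint D 1" for h
    using adjoint_works[of D h 1] by simp
  then have "D = (\<lambda>h. h \<bullet> adjoint D 1)"
    by blast
  with D have "GDERIV f u :> adjoint D 1"
    unfolding gderiv_def by simp
  with grad_eqI show ?thesis
    by metis
qed

definition C11_loc :: "('a::euclidean_space \<Rightarrow> real) \<Rightarrow> bool" where
  "C11_loc G \<longleftrightarrow>
     (\<forall>u. G differentiable (at u)) \<and>
     (\<forall>u. \<exists>r>0. \<exists>L. L-lipschitz_on (ball u r) (grad G))"

definition crit :: "('a::euclidean_space \<Rightarrow> real) \<Rightarrow> 'a set" where
  "crit G = {u. grad G u = 0}"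

text \<open>The function \<open>\<phi>\<close> lives on \<open>[0, r\<^sub>0)\<close>; its values elsewhere are irrelevant. Where
  \<open>G u \<noteq> G ubar\<close>, the composition in the last conjunct is differentiable at \<open>u\<close> by the other
  conjuncts, so its gradient is well defined.\<close>
definition desingularizing_on ::
    "('a::euclidean_space \<Rightarrow> real) \<Rightarrow> 'a \<Rightarrow> real \<Rightarrow> real \<Rightarrow> (real \<Rightarrow> real) \<Rightarrow> bool" where
  "desingularizing_on G ubar r\<^sub>0 \<eta> \<phi> \<longleftrightarrow>
     (\<forall>u. G differentiable (at u)) \<and>
     r\<^sub>0 > 0 \<and> \<eta> > 0 \<and>
     continuous_on {0..<r\<^sub>0} \<phi> \<and> (\<forall>s\<in>{0..<r\<^sub>0}. \<phi> s \<ge> 0) \<and>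
     \<phi> 0 = 0 \<and>
     (\<forall>s\<in>{0<..<r\<^sub>0}. \<phi> differentiable (at s)) \<and> continuous_on {0<..<r\<^sub>0} (deriv \<phi>) \<and>
     concave_on {0..<r\<^sub>0} \<phi> \<and>
     (\<forall>s\<in>{0<..<r\<^sub>0}. deriv \<phi> s > 0) \<and>
     (\<forall>u\<in>ball ubar \<eta>. \<bar>G u - G ubar\<bar> < r\<^sub>0) \<and>
     (\<forall>u\<in>ball ubar \<eta>. G u \<noteq> G ubar \<longrightarrow> norm (grad (\<lambda>v. \<phi> \<bar>G v - G ubar\<bar>) u) \<ge> 1)"

definition desingularizing ::
    "('a::euclidean_space \<Rightarrow> real) \<Rightarrow> 'a \<Rightarrow> (real \<Rightarrow> real) \<Rightarrow> bool" where
  "desingularizing G ubar \<phi> \<longleftrightarrow> (\<exists>r\<^sub>0 \<eta>. desingularizing_on G ubar r\<^sub>0 \<eta> \<phi>)"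

definition KL_property :: "('a::euclidean_space \<Rightarrow> real) \<Rightarrow> 'a \<Rightarrow> bool" where
  "KL_property G ubar \<longleftrightarrow> (\<exists>\<phi>. desingularizing G ubar \<phi>)"

end

theory Submission
  imports Defs
begin

text \<open>Let \<open>L\<close> be a Lipschitz constant of the gradient near \<open>ubar\<close>. Where \<open>G u > G ubar\<close>, a
  gradient step of length \<open>1 / (2 L)\<close> cannot cross the level \<open>G ubar\<close>: a point of that level is
  critical, whereas the gradient at most halves along the step. As \<open>G\<close> decreases by at least
  \<open>(norm (grad G u))\<^sup>2 / (4 L)\<close> along the step, the squared norm of the gradient is at most
  \<open>4 L (G u - G ubar)\<close>; below the level \<open>G ubar\<close>, the same holds for \<open>- G\<close>. In the KL
  inequality this gives \<open>\<phi>' s \<ge> 1 / (2 sqrt (L s))\<close> at each value \<open>s\<close> of \<open>\<bar>G u - G ubar\<bar>\<close>,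
  and by nontriviality of \<open>ubar\<close> and connectedness all small \<open>s > 0\<close> are such values.\<close>

lemma norm_gradient_squared_le:
  fixes F :: "'a::euclidean_space \<Rightarrow> real" and g :: "'a \<Rightarrow> 'a"
  assumes F: "\<And>x. GDERIV F x :> g x"
    and lip: "L-lipschitz_on (ball c r) g" and L: "L > 0"
    and c: "g c = 0"
    and zero: "\<And>x. x \<in> ball c r \<Longrightarrow> F x = 0 \<Longrightarrow> g x = 0"
    and u: "u \<in> ball c (r / 2)" and pos: "F u > 0"
  shows "(norm (g u))\<^sup>2 \<le> 4 * L * F u"
proof (cases "g u = 0")
  case True
  then show ?thesis
    using L pos by simp
next
  case False
  \<comment> \<open>With \<open>L * T = 1 / 2\<close>, the Lipschitz bound lets the gradient change
    along the step by at most half of its initial norm.\<close>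
  define T where "T = 1 / (2 * L)"
  define p where "p t = u - t *\<^sub>R g u" for t
  define f where "f t = F (p t)" for t
  have T: "T > 0" "L * T = 1 / 2"
    using L by (auto simp: T_def)
  have dist_cu: "dist c u < r / 2"
    using u by simp
  have u_ball: "u \<in> ball c r" and c_ball: "c \<in> ball c r"
    using dist_cu zero_le_dist[of c u] by (simp_all del: zero_le_dist)
  have norm_gu: "norm (g u) \<le> L * dist c u"
    using lipschitz_onD[OF lip c_ball u_ball] c by simp
  \<comment> \<open>As \<open>c\<close> is critical, \<open>norm (g u) \<le> L * dist c u\<close>,
    so the step moves \<open>u\<close> by at most \<open>dist c u / 2\<close>. Starting in the ball
    of radius \<open>r / 2\<close>, it stays within \<open>3 * r / 4\<close> of
    \<open>c\<close>.\<close>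
  have p_ball: "p t \<in> ball c r" if "0 \<le> t" "t \<le> T" for t
  proof -
    have "dist c (p t) \<le> dist c u + t * norm (g u)"
      using that dist_triangle[of c "p t" u] by (simp add: p_def dist_norm)
    also have "\<dots> \<le> dist c u + T * (L * dist c u)"
      using that norm_gu T by (intro add_left_mono mult_mono) auto
    also have "\<dots> = dist c u + L * T * dist c u"
      by simp
    also have "\<dots> < r"
      using dist_cu zero_le_dist[of c u] unfolding T by linarith
    finally show ?thesis
      by simp
  qed
  have step: "norm (g (p t) - g u) \<le> norm (g u) / 2" if "0 \<le> t" "t \<le> T" for t
  proof -
    have "norm (g (p t) - g u) \<le> L * (t * norm (g u))"
      using lipschitz_onD[OF lip p_ball[OF that] u_ball] that by (simp add: p_def dist_norm)
    also have "\<dots> \<le> L * (T * norm (g u))"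
      using that L by (intro mult_left_mono mult_right_mono) auto
    also have "\<dots> = L * T * norm (g u)"
      by simp
    finally show ?thesis
      unfolding T by simp
  qed
  have f_deriv: "(f has_real_derivative - (g u \<bullet> g (p t))) (at t)" for t
  proof -
    have "(p has_derivative (\<lambda>h. - (h *\<^sub>R g u))) (at t)"
      unfolding p_def by (auto intro!: derivative_eq_intros)
    moreover have "(F has_derivative (\<lambda>h. h \<bullet> g (p t))) (at (p t))"
      using F unfolding gderiv_def .
    ultimately have "(f has_derivative (\<lambda>h. - (h *\<^sub>R g u) \<bullet> g (p t))) (at t)"
      unfolding f_def by (rule has_derivative_compose)
    then show ?thesis
      by (rule has_derivative_imp_has_field_derivative) simp
  qed
  \<comment> \<open>A zero of \<open>f\<close> would make \<open>g (p t)\<close> vanish by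
    \<open>zero\<close>; then \<open>step\<close> reads
    \<open>norm (g u) \<le> norm (g u) / 2\<close>, contradicting
    \<open>g u \<noteq> 0\<close>.\<close>
  have f_nonzero: "f t \<noteq> 0" if "0 \<le> t" "t \<le> T" for t
    using zero[OF p_ball[OF that]] step[OF that] False by (auto simp: f_def)
  have "f T > 0"
  proof (rule ccontr)
    assume "\<not> f T > 0"
    moreover have "f 0 > 0"
      using pos by (simp add: f_def p_def)
    moreover have "continuous_on {0..T} f"
      using f_deriv by (auto intro!: DERIV_isCont continuous_at_imp_continuous_on)
    ultimately obtain t where "0 \<le> t" "t \<le> T" "f t = 0"
      using IVT2'[of f T 0 0] T by auto
    with f_nonzero show False
      by blast
  qed
  obtain z where z: "0 < z" "z < T" "f T - f 0 = - (T * (g u \<bullet> g (p z)))"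
    using MVT2[of 0 T f "\<lambda>t. - (g u \<bullet> g (p t))"] f_deriv T by auto
  have "(norm (g u))\<^sup>2 / 2 \<le> g u \<bullet> g (p z)"
  proof -
    have "- (g u \<bullet> (g (p z) - g u)) \<le> norm (g u) * norm (g (p z) - g u)"
      using Cauchy_Schwarz_ineq2[of "g u" "g (p z) - g u"] by linarith
    also have "\<dots> \<le> norm (g u) * (norm (g u) / 2)"
      using step[of z] z by (intro mult_left_mono) auto
    finally show ?thesis
      by (simp add: inner_diff_right power2_norm_eq_inner power2_eq_square[of "norm _", symmetric])
  qed
  then have "T * ((norm (g u))\<^sup>2 / 2) \<le> T * (g u \<bullet> g (p z))"
    using T by (intro mult_left_mono) auto
  \<comment> \<open>The decrease \<open>f 0 - f T\<close> is less than \<open>f 0 = F u\<close>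
    because the end value is positive.\<close>
  with z(3) \<open>f T > 0\<close> have "T * ((norm (g u))\<^sup>2 / 2) < f 0"
    by linarith
  then show ?thesis
    using L by (simp add: T_def f_def p_def field_simps)
qed

theorem proposition2p8:
  fixes G :: "real ^ 'n \<Rightarrow> real" and ubar :: "real ^ 'n"
  assumes "C11_loc G"
    and "ubar \<in> crit G - interior (crit G)"
    and "KL_property G ubar"
    and "\<exists>\<eta>>0. \<forall>u\<in>ball ubar \<eta>. G u = G ubar \<longrightarrow> u \<in> crit G"
  shows "\<exists>\<beta>>0. \<forall>\<phi>. desingularizing G ubar \<phi> \<longrightarrow>
           (\<forall>\<^sub>F s in at_right 0. deriv \<phi> s \<ge> \<beta> / sqrt s)"
proof -
  have G: "GDERIV G u :> grad G u" for u
    using assms(1) GDERIV_grad by (auto simp: C11_loc_def)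
  have G_diff: "GDERIV (\<lambda>v. G v - G ubar) u :> grad G u" for u
    using GDERIV_diff[OF G GDERIV_const] by simp
  obtain \<eta> where \<eta>: "\<eta> > 0" "\<And>u. u \<in> ball ubar \<eta> \<Longrightarrow> G u = G ubar \<Longrightarrow> grad G u = 0"
    using assms(4) by (auto simp: crit_def)
  obtain r\<^sub>1 L\<^sub>1 where r\<^sub>1: "r\<^sub>1 > 0" "L\<^sub>1-lipschitz_on (ball ubar r\<^sub>1) (grad G)"
    using assms(1) by (meson C11_loc_def)
  define r where "r = min r\<^sub>1 \<eta>"
  \<comment> \<open>A Lipschitz constant may be 0; the maximum with 1 allows division by
    \<open>L\<close>.\<close>
  define L where "L = max L\<^sub>1 1"
  have r: "r > 0" and L: "L > 0"
    using \<eta> r\<^sub>1 by (auto simp: r_def L_def)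
  have lip: "L-lipschitz_on (ball ubar r) (grad G)"
    using r\<^sub>1(2) by (rule lipschitz_on_mono) (auto simp: L_def r_def)
  have crit: "grad G ubar = 0"
    using assms(2) by (simp add: crit_def)
  \<comment> \<open>The sign \<open>e\<close> treats both sides of the level at once: multiplying by
    it changes neither the Lipschitz constant nor the norm of the gradient.\<close>
  have sgn_bound: "(norm (grad G u))\<^sup>2 \<le> 4 * L * (e * (G u - G ubar))"
    if u: "u \<in> ball ubar (r / 2)" and e: "\<bar>e\<bar> = 1" "e * (G u - G ubar) > 0" for u e
  proof -
    have "GDERIV (\<lambda>v. e * (G v - G ubar)) x :> e *\<^sub>R grad G x" for x
      using GDERIV_mult[OF GDERIV_const G_diff] by simp
    moreover have "L-lipschitz_on (ball ubar r) (\<lambda>x. e *\<^sub>R grad G x)"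
      using lipschitz_on_cmult[OF lip, of e] e by simp
    ultimately have "(norm (e *\<^sub>R grad G u))\<^sup>2 \<le> 4 * L * (e * (G u - G ubar))"
      using L crit \<eta>(2) u e
      by (intro norm_gradient_squared_le[where c = ubar and r = r]) (auto simp: r_def)
    then show ?thesis
      using e by simp
  qed
  have bound: "(norm (grad G u))\<^sup>2 \<le> 4 * L * \<bar>G u - G ubar\<bar>"
    if "u \<in> ball ubar (r / 2)" "G u \<noteq> G ubar" for u
    using sgn_bound[OF that(1), of "sgn (G u - G ubar)"] that(2) 
    by (cases "G u > G ubar") auto
  \<comment> \<open>The constant involves only \<open>L\<close>, fixed before \<phi>; only the range
    of admissible \<open>s\<close> depends on \<phi>.\<close>
  have "\<forall>\<^sub>F s in at_right 0. deriv \<phi> s \<ge> 1 / (2 * sqrt L) / sqrt s"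
    if des: "desingularizing G ubar \<phi>" for \<phi>
  proof -
    obtain r\<^sub>0 \<eta>' where "desingularizing_on G ubar r\<^sub>0 \<eta>' \<phi>"
      using des by (auto simp: desingularizing_def)
    then have \<eta>': "\<eta>' > 0"
      and \<phi>_diff: "\<And>s. 0 < s \<Longrightarrow> s < r\<^sub>0 \<Longrightarrow> \<phi> differentiable (at s)"
      and \<phi>_pos: "\<And>s. 0 < s \<Longrightarrow> s < r\<^sub>0 \<Longrightarrow> deriv \<phi> s > 0"
      and less_r0: "\<And>u. u \<in> ball ubar \<eta>' \<Longrightarrow> \<bar>G u - G ubar\<bar> < r\<^sub>0"
      and KL: "\<And>u. u \<in> ball ubar \<eta>' \<Longrightarrow> G u \<noteq> G ubar \<Longrightarrow>
        norm (grad (\<lambda>v. \<phi> \<bar>G v - G ubar\<bar>) u) \<ge> 1"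
      by (auto simp: desingularizing_on_def)
    define \<rho> where "\<rho> = min (r / 2) \<eta>'"
    have \<rho>: "\<rho> > 0"
      using r \<eta>' by (simp add: \<rho>_def)
    have "\<not> ball ubar \<rho> \<subseteq> crit G"
      using assms(2) \<rho> by (auto simp: mem_interior)
    \<comment> \<open>A noncritical point this close to \<open>ubar\<close> lies off the level of
      \<open>ubar\<close>, since points on it are critical.\<close>
    then obtain w where w: "w \<in> ball ubar \<rho>" "G w \<noteq> G ubar"
      using \<eta>(2) r by (force simp: crit_def \<rho>_def r_def)
    define h where "h v = \<bar>G v - G ubar\<bar>" for v
    have "continuous_on (ball ubar \<rho>) G"
      using G has_derivative_continuous unfolding gderiv_def
      by (intro continuous_at_imp_continuous_on) blast
    then have "continuous_on (ball ubar \<rho>) h"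
      unfolding h_def by (intro continuous_intros)
    then have conn: "connected (h ` ball ubar \<rho>)"
      by (intro connected_continuous_image convex_connected convex_ball)
    have "deriv \<phi> s \<ge> 1 / (2 * sqrt L) / sqrt s" if s: "0 < s" "s < h w" for s
    proof -
      have "h ubar \<in> h ` ball ubar \<rho>" "h w \<in> h ` ball ubar \<rho>"
        using \<rho> w by auto
      moreover have "h ubar = 0"
        by (simp add: h_def)
      ultimately have "s \<in> h ` ball ubar \<rho>"
        using connectedD_interval[OF conn] s by (metis less_imp_le)
      then obtain u where u: "u \<in> ball ubar \<rho>" "h u = s"
        by auto
      then have Gu: "G u \<noteq> G ubar" and s_r0: "s < r\<^sub>0"
        using s less_r0[of u] by (auto simp: h_def \<rho>_def)
      \<comment> \<open>On the reals the norm is \<open>abs\<close>, so its gradient away from 0 is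
        the sign, which has modulus 1 and drops out of the KL inequality.\<close>
      have "DERIV abs (G u - G ubar) :> sgn (G u - G ubar)"
        using GDERIV_norm[of "G u - G ubar"] Gu
        by (simp add: gderiv_def has_field_derivative_def mult.commute[of _ "sgn _"])
      from GDERIV_DERIV_compose[OF G_diff this]
      have abs: "GDERIV h u :> sgn (G u - G ubar) *\<^sub>R grad G u"
        unfolding h_def .
      have "DERIV \<phi> (h u) :> deriv \<phi> s"
        using \<phi>_diff[OF s(1) s_r0] u by (simp add: DERIV_deriv_iff_real_differentiable)
      from grad_eqI[OF GDERIV_DERIV_compose[OF abs this]]
      have "grad (\<lambda>v. \<phi> (h v)) u = deriv \<phi> s *\<^sub>R sgn (G u - G ubar) *\<^sub>R grad G u" .
      then have "1 \<le> deriv \<phi> s * norm (grad G u)"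
        using KL[of u] u Gu \<phi>_pos[OF s(1) s_r0]
        by (auto simp: h_def \<rho>_def abs_mult abs_sgn_eq)
      also have "norm (grad G u) \<le> sqrt (4 * L * s)"
        using bound[of u] u Gu by (intro real_le_rsqrt) (auto simp: h_def \<rho>_def)
      then have "deriv \<phi> s * norm (grad G u) \<le> deriv \<phi> s * (2 * sqrt L * sqrt s)"
        using \<phi>_pos[OF s(1) s_r0] by (intro mult_left_mono) (auto simp: real_sqrt_mult)
      finally show ?thesis
        using L s by (simp add: field_simps)
    qed
    then show ?thesis
      using w by (auto simp: eventually_at_right_field h_def intro!: exI[of _ "h w"])
  qed
  then show ?thesis
    using L by (intro exI[of _ "1 / (2 * sqrt L)"]) auto
qed

end
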